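(* Let $\mathbf{p}_1,\ldots,\mathbf{p}_d\in\Pi^n_o$, $P=(\mathbf{p}_1,\ldots,\mathbf{p}_d)$. Assume that the tensor $\mathcal{A}\in\otimes^d\mathbb{R}^n$ is positive (all entries are positive), and let $\mathcal{A}_k$, $X^{(k)}=(\mathbf{x}^{(k)}_1,\ldots,\mathbf{x}^{(k)}_d)$, $\ell(k)$ be produced by the Sinkhorn algorithm started at $\mathcal{A}_0=\mathcal{A}$, $X^{(0)}=\mathbf{0}$ (described in the context). Then: (a) The Sinkhorn algorithm converges geometrically to a unique $\mathcal{U}\in\mathrm{U}(P)$, i.e. the sequence $\mathcal{A}_k$ converges geometrically to a unique $\mathcal{U}\in \mathrm{U}(P)$. (b) The sequence $\mathcal{K}(\mathbf{p}_j\|\mathbf{s}_j(\mathcal{A}_k))$, $k\in\mathbb{N}$, converges geometrically to $0$ for each $j\in[d]$. (c) The sequence $X^{(k)}$ converges geometrically to a minimum point $X^\star$ of $g_{\mathcal{A}}$. (d) For $k\ge 1$ and $l=\ell(k)$ we have $$g_{\mathcal{A}}(X^{(k)})-g_{\mathcal{A}}(X^{(k+1)})=\sum_{j=1}^d\langle\mathbf{p}_j,\mathbf{x}_j^{(k+1)}-\mathbf{x}_j^{(k)}\rangle=\langle\mathbf{p}_l,\mathbf{x}_l^{(k+1)}-\mathbf{x}_l^{(k)}\rangle=\mathcal{K}(\mathbf{p}_l\|\mathbf{s}_l(\mathcal{A}_k)).$$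
   Context: $[n]=\{1,\ldots,n\}$, $d\ge2$. $\otimes^d\mathbb{R}^n$ is the space of real tensors $\mathcal{U}=[u_{i_1,\ldots,i_d}]$, $i_1,\ldots,i_d\in[n]$; $\otimes^d\mathbb{R}^n_+$ those with nonnegative entries. $\Pi^n_o$ is the set of probability vectors in $\mathbb{R}^n$ with all coordinates positive; $\mathbf{p}_j=(p_{1,j},\ldots,p_{n,j})$. For $l\in[d]$, $\mathbf{s}_l(\mathcal{A})=(s_{1,l}(\mathcal{A}),\ldots,s_{n,l}(\mathcal{A}))$ with $s_{i_l,l}(\mathcal{A})=\sum_{i_j\in[n],\,j\ne l}a_{i_1,\ldots,i_d}$. $\mathrm{U}(P)=\{\mathcal{U}\in\otimes^d\mathbb{R}^n_+:\ \mathbf{s}_j(\mathcal{U})=\mathbf{p}_j,\ j\in[d]\}$. $\|\cdot\|$ is the Euclidean norm and $\|\cdot\|_1$ the $\ell_1$ norm. $\mathcal{K}(\mathbf{p}\|\mathbf{q})=\sum_{i=1}^n p_i(\log p_i-\log q_i)$ is the Kullback–Leibler divergence. For $Y=(\mathbf{y}_1,\ldots,\mathbf{y}_d)\in(\mathbb{R}^n)^d$, $\mathbf{y}_j=(y_{1,j},\ldots,y_{n,j})$, $$g_{\mathcal{A}}(Y)=\sum_{i_1,\ldots,i_d\in[n]}a_{i_1,\ldots,i_d}\exp\Big(\sum_{j\in[d]}y_{i_j,j}\Big)-\sum_{j\in[d]}\sum_{i_j\in[n]}p_{i_j,j}y_{i_j,j}.$$ Sinkhorn algorithm. For a tensor $\mathcal{A}$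 with positive marginals let $\mathbf{x}_l(\mathcal{A})\in\mathbb{R}^n$ have coordinates $x_{i,l}(\mathcal{A})=\log p_{i,l}-\log s_{i,l}(\mathcal{A})$. Start with $X^{(0)}=\mathbf{0}$, $\mathcal{A}_0=\mathcal{A}$. Given $X^{(k-1)}$, $k\in\mathbb{N}$, put $\mathcal{A}_{k-1}=[\exp(\sum_{j\in[d]}x^{(k-1)}_{i_j,j})\,a_{i_1,\ldots,i_d}]$, choose $$\ell(k-1)\in\arg\max\Big\{\Big\|\mathbf{s}_j(\mathcal{A}_{k-1})-\frac{\langle\mathbf{s}_j(\mathcal{A}_{k-1}),\mathbf{p}_j\rangle}{\|\mathbf{p}_j\|^2}\mathbf{p}_j\Big\|_1:\ j\in[d]\Big\},$$ and set $\mathbf{x}^{(k)}_j=\mathbf{x}^{(k-1)}_j$ for $j\ne\ell(k-1)$, and $\mathbf{x}^{(k)}_j=\mathbf{x}^{(k-1)}_j+\mathbf{x}_j(\mathcal{A}_{k-1})$ for $j=\ell(k-1)$. A sequence $z_k$ converges geometrically to $z$ if there are constants $K>0$ and $r\in(0,1)$ with $\|z_k-z\|\le K r^k$ for all $k$. *)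

theory Defs
  imports "HOL-Analysis.Analysis"
begin

text \<open>
  The sizes \<open>n\<close> and \<open>d\<close> are the cardinalities of the finite index types \<open>'n\<close> and \<open>'d\<close>.
  A tensor in the \<open>d\<close>-fold tensor power of \<open>\<real>\<^sup>n\<close> is a vector indexed by the multi-indices
  \<open>m :: 'n ^ 'd\<close>, with \<open>m $ j\<close> standing for \<open>i\<^sub>j\<close>; its library norm is therefore the Euclidean
  norm of the entries. A tuple \<open>(y\<^sub>1, \<dots>, y\<^sub>d)\<close> of vectors is \<open>Y :: real ^ 'n ^ 'd\<close>, with
  \<open>Y $ j $ i\<close> standing for \<open>y\<^sub>i\<^sub>,\<^sub>j\<close>.
\<close>

type_synonym ('n, 'd) tensor = "(real, ('n, 'd) vec) vec"

definition pos_prob_vectors :: "(real ^ 'n) set" where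
  "pos_prob_vectors = {q. (\<forall>i. 0 < q $ i) \<and> (\<Sum>i\<in>UNIV. q $ i) = 1}"

definition marginal :: "'d \<Rightarrow> ('n::finite, 'd::finite) tensor \<Rightarrow> real ^ 'n" where
  "marginal l A = (\<chi> i. \<Sum>m | m $ l = i. A $ m)"

definition transport_polytope :: "real ^ 'n ^ 'd \<Rightarrow> ('n::finite, 'd::finite) tensor set" where
  "transport_polytope p = {U. (\<forall>m. 0 \<le> U $ m) \<and> (\<forall>j. marginal j U = p $ j)}"

definition l1_norm :: "real ^ 'n \<Rightarrow> real" where
  "l1_norm x = (\<Sum>i\<in>UNIV. \<bar>x $ i\<bar>)"

text \<open>
  Here \<open>r\<close> need not sum to one; it may be a marginal of the initial, unnormalised tensor.
\<close>

definition kl_div :: "real ^ 'n \<Rightarrow> real ^ 'n \<Rightarrow> real" where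
  "kl_div q r = (\<Sum>i\<in>UNIV. q $ i * (ln (q $ i) - ln (r $ i)))"

definition g_fun :: "('n::finite, 'd::finite) tensor \<Rightarrow> real ^ 'n ^ 'd \<Rightarrow> real ^ 'n ^ 'd \<Rightarrow> real" where
  "g_fun A p Y = (\<Sum>m\<in>UNIV. A $ m * exp (\<Sum>j\<in>UNIV. Y $ j $ (m $ j)))
     - (\<Sum>j\<in>UNIV. \<Sum>i\<in>UNIV. p $ j $ i * Y $ j $ i)"

definition rescale :: "('n::finite, 'd::finite) tensor \<Rightarrow> real ^ 'n ^ 'd \<Rightarrow> ('n, 'd) tensor" where
  "rescale A X = (\<chi> m. exp (\<Sum>j\<in>UNIV. X $ j $ (m $ j)) * A $ m)"

definition log_ratio :: "real ^ 'n ^ 'd \<Rightarrow> 'd \<Rightarrow> ('n::finite, 'd::finite) tensor \<Rightarrow> real ^ 'n" where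
  "log_ratio p l A = (\<chi> i. ln (p $ l $ i) - ln (marginal l A $ i))"

definition deviation :: "real ^ 'n ^ 'd \<Rightarrow> ('n::finite, 'd::finite) tensor \<Rightarrow> 'd \<Rightarrow> real" where
  "deviation p A j =
     l1_norm (marginal j A - ((marginal j A \<bullet> p $ j) / (norm (p $ j))\<^sup>2) *\<^sub>R (p $ j))"

text \<open>
  A run of the algorithm consists of the iterates \<open>X k\<close> together with the chosen modes \<open>l k\<close>.
  Ties in the arg max may be broken arbitrarily, so this is a relation; the tensor at step
  \<open>k\<close> is \<open>rescale A (X k)\<close>.
\<close>

definition sinkhorn_run ::
  "('n::finite, 'd::finite) tensor \<Rightarrow> real ^ 'n ^ 'd \<Rightarrow> (nat \<Rightarrow> real ^ 'n ^ 'd) \<Rightarrow> (nat \<Rightarrow> 'd) \<Rightarrow> bool"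
where
  "sinkhorn_run A p X l \<longleftrightarrow> X 0 = 0 \<and>
     (\<forall>k. is_arg_max (deviation p (rescale A (X k))) (\<lambda>j. True) (l k) \<and>
          X (Suc k) = (\<chi> j. if j = l k then X k $ j + log_ratio p j (rescale A (X k))
                             else X k $ j))"

definition converges_geometrically :: "(nat \<Rightarrow> 'a::real_normed_vector) \<Rightarrow> 'a \<Rightarrow> bool" where
  "converges_geometrically z w \<longleftrightarrow>
     (\<exists>K r. 0 < K \<and> 0 < r \<and> r < 1 \<and> (\<forall>k. norm (z k - w) \<le> K * r ^ k))"

end

theory Submission imports Defs begin

text \<open>
  Scaled by \<open>X k\<close>, the tensor becomes \<open>B k\<close>; a step multiplies \<open>B k\<close> along the mode \<open>l k\<close> so as
  to correct that marginal, and raises \<open>\<Sum>j. \<langle>p\<^sub>j, x\<^sub>j\<rangle>\<close> by the divergence \<open>K(p\<^sub>l, s\<^sub>l)\<close>. Positivity of \<open>A\<close>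
  bounds the oscillation of every \<open>x\<^sub>j\<close>, so the iterates stay bounded and accumulate at some
  \<open>Z\<close> whose scaled tensor \<open>U\<close> has the prescribed marginals. The remaining gap
  \<open>\<Sum>j. \<langle>p\<^sub>j, z\<^sub>j - x\<^sub>j\<rangle>\<close> is the relative entropy of \<open>U\<close> with respect to \<open>B k\<close>. It is at most
  quadratic in the marginal errors, and these are controlled by the divergence in the chosen mode,
  that is, by the decrease of the gap. So the gap decays geometrically, and with it the
  squared length of the steps.
\<close>

section \<open>Geometric convergence\<close>

lemma converges_geometrically_compare:
  assumes "converges_geometrically z w" and "\<And>k. norm (y k - v) \<le> C * norm (z k - w)"
  shows "converges_geometrically y v"
proof -
  obtain K r where K: "0 < K" "0 < r" "r < 1" "\<And>k. norm (z k - w) \<le> K * r ^ k"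
    using assms(1) unfolding converges_geometrically_def by blast
  have "norm (y k - v) \<le> ((\<bar>C\<bar> + 1) * K) * r ^ k" for k
  proof -
    have "norm (y k - v) \<le> C * norm (z k - w)" by (rule assms(2))
    also have "\<dots> \<le> (\<bar>C\<bar> + 1) * norm (z k - w)" by (intro mult_right_mono) auto
    also have "\<dots> \<le> (\<bar>C\<bar> + 1) * (K * r ^ k)" by (intro mult_left_mono K) auto
    finally show ?thesis by (simp add: mult.assoc)
  qed
  moreover have "0 < (\<bar>C\<bar> + 1) * K"
    using K(1) by (intro mult_pos_pos) auto
  ultimately show ?thesis
    using K unfolding converges_geometrically_def by blast
qed

text \<open>The initial tensor has arbitrary mass, so the estimates below start at index 1; the
  shift costs a factor \<open>1 / r\<close> and an additive constant for index 0.\<close>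

lemma converges_geometrically_unshift:
  assumes "converges_geometrically (\<lambda>k. z (Suc k)) w"
  shows "converges_geometrically z w"
proof -
  obtain K r where K: "0 < K" "0 < r" "r < 1" "\<And>k. norm (z (Suc k) - w) \<le> K * r ^ k"
    using assms unfolding converges_geometrically_def by blast
  let ?K = "K / r + norm (z 0 - w)"
  have "norm (z k - w) \<le> ?K * r ^ k" for k
  proof (cases k)
    case 0
    then show ?thesis using K by simp
  next
    case (Suc n)
    have "norm (z k - w) \<le> (K / r) * r ^ k" using K(4)[of n] K(2) Suc by simp
    also have "\<dots> \<le> ?K * r ^ k" using K(2) by (intro mult_right_mono) auto
    finally show ?thesis .
  qed
  moreover have "0 < ?K" using K by (simp add: add_pos_nonneg)
  ultimately show ?thesis
    using K unfolding converges_geometrically_def by blast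
qed

lemma converges_geometrically_imp_tendsto:
  assumes "converges_geometrically z w"
  shows "z \<longlonglongrightarrow> w"
proof -
  obtain K r where K: "0 < K" "0 < r" "r < 1" "\<And>k. norm (z k - w) \<le> K * r ^ k"
    using assms unfolding converges_geometrically_def by blast
  have "(\<lambda>k. K * r ^ k) \<longlonglongrightarrow> 0"
    using K by (intro tendsto_mult_right_zero LIMSEQ_realpow_zero) auto
  then have "(\<lambda>k. z k - w) \<longlonglongrightarrow> 0"
    by (rule Lim_null_comparison[rotated]) (simp add: K(4))
  then show ?thesis by (simp add: LIM_zero_iff)
qed

text \<open>Geometrically small steps make the tails geometrically small, and the convergent
  subsequence takes the place of completeness in supplying the limit.\<close>

lemma converges_geometrically_of_steps:
  fixes z :: "nat \<Rightarrow> 'a::real_normed_vector"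
  assumes step: "\<And>k. norm (z (Suc k) - z k) \<le> K * r ^ k" and r: "0 < r" "r < 1"
    and f: "strict_mono f" "(z \<circ> f) \<longlonglongrightarrow> w"
  shows "converges_geometrically z w"
proof -
  have "0 \<le> K" using order_trans[OF norm_ge_zero step[of 0]] by simp
  have tail: "norm (z (k + n) - z k) \<le> K / (1 - r) * (r ^ k - r ^ (k + n))" for k n
  proof (induction n)
    case (Suc n)
    have "norm (z (k + Suc n) - z k) \<le> norm (z (Suc (k + n)) - z (k + n)) + norm (z (k + n) - z k)"
      using norm_triangle_ineq[of "z (Suc (k + n)) - z (k + n)" "z (k + n) - z k"] by simp
    also have "\<dots> \<le> K * r ^ (k + n) + K / (1 - r) * (r ^ k - r ^ (k + n))"
      by (intro add_mono step Suc.IH)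
    also have "\<dots> = K / (1 - r) * (r ^ k - r ^ (k + Suc n))"
      using r by (simp add: field_simps)
    finally show ?case .
  qed simp
  have bound: "norm (z k - w) \<le> K / (1 - r) * r ^ k" for k
  proof (rule Lim_bounded)
    show "(\<lambda>n. norm (z k - (z \<circ> f) n)) \<longlonglongrightarrow> norm (z k - w)"
      by (intro tendsto_intros f(2))
    show "\<forall>n\<ge>k. norm (z k - (z \<circ> f) n) \<le> K / (1 - r) * r ^ k"
    proof (intro allI impI)
      fix n assume "k \<le> n"
      then have "k \<le> f n" using seq_suble[OF f(1)] order_trans by blast
      then have "norm (z k - z (f n)) \<le> K / (1 - r) * (r ^ k - r ^ f n)"
        using tail[of k "f n - k"] by (simp add: norm_minus_commute)
      also have "\<dots> \<le> K / (1 - r) * r ^ k"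
        using \<open>0 \<le> K\<close> r by (intro mult_left_mono) auto
      finally show "norm (z k - (z \<circ> f) n) \<le> K / (1 - r) * r ^ k" by simp
    qed
  qed
  \<comment> \<open>Adding 1 keeps the constant positive even when \<open>K = 0\<close>.\<close>
  have "norm (z k - w) \<le> (K / (1 - r) + 1) * r ^ k" for k
    using bound[of k] r zero_le_power[of r k] by (simp add: distrib_right add_increasing2)
  moreover have "0 < K / (1 - r) + 1"
    using \<open>0 \<le> K\<close> r by (simp add: add_nonneg_pos)
  ultimately show ?thesis
    using r unfolding converges_geometrically_def by blast
qed

section \<open>Logarithms and norms\<close>

lemma ln_diff_le:
  fixes u b :: real
  assumes "0 < u" "0 < b"
  shows "ln u - ln b \<le> (u - b) / b"
  using ln_le_minus_one[of "u / b"] assms by (simp add: ln_div diff_divide_distrib)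

lemma abs_ln_diff_le:
  fixes u b :: real
  assumes "0 < c" "c \<le> u" "c \<le> b"
  shows "\<bar>ln u - ln b\<bar> \<le> \<bar>u - b\<bar> / c"
proof -
  have *: "ln x - ln y \<le> \<bar>x - y\<bar> / c" if "c \<le> x" "c \<le> y" for x y
  proof -
    have "ln x - ln y \<le> (x - y) / y" using that assms(1) by (intro ln_diff_le) auto
    also have "\<dots> \<le> \<bar>x - y\<bar> / y" using that assms(1) by (intro divide_right_mono) auto
    also have "\<dots> \<le> \<bar>x - y\<bar> / c" using that assms(1) by (intro divide_left_mono) auto
    finally show ?thesis .
  qed
  show ?thesis using *[of u b] *[of b u] assms by (simp add: abs_le_iff abs_minus_commute)
qed

text \<open>On (0, 1] the derivative of \<open>ln\<close> is at least 1, so \<open>ln\<close> does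
  not shrink distances there.\<close>

lemma abs_diff_le_ln:
  fixes u b :: real
  assumes "0 < u" "u \<le> 1" "0 < b" "b \<le> 1"
  shows "\<bar>u - b\<bar> \<le> \<bar>ln u - ln b\<bar>"
proof -
  have *: "x - y \<le> \<bar>ln x - ln y\<bar>" if "0 < x" "x \<le> 1" "0 < y" for x y :: real
  proof -
    have "x - y \<le> x * (ln x - ln y)"
      using ln_diff_le[OF that(3,1)] that by (simp add: field_simps)
    also have "\<dots> \<le> x * \<bar>ln x - ln y\<bar>" using that by (intro mult_left_mono) auto
    also have "\<dots> \<le> \<bar>ln x - ln y\<bar>" using that by (simp add: mult_left_le_one_le)
    finally show ?thesis .
  qed
  show ?thesis using *[of u b] *[of b u] assms by (simp add: abs_le_iff abs_minus_commute)
qed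

lemma diff_mult_ln_diff_nonneg:
  fixes u b :: real
  assumes "0 < u" "0 < b"
  shows "0 \<le> (u - b) * (ln u - ln b)"
  using assms by (cases "u \<le> b") (auto intro: mult_nonneg_nonneg mult_nonpos_nonpos)

text \<open>Squaring turns \<open>ln t \<le> t - 1\<close> at \<open>t = sqrt (s / q)\<close> into a bound by the Hellinger distance.\<close>

lemma kl_term_ge:
  fixes q s :: real
  assumes "0 < q" "q \<le> 1" "0 < s" "s \<le> 1"
  shows "q - s + (q - s)\<^sup>2 / 4 \<le> q * (ln q - ln s)"
proof -
  define x y where "x = sqrt q" and "y = sqrt s"
  have xy: "0 < x" "x \<le> 1" "0 < y" "y \<le> 1" "q = x\<^sup>2" "s = y\<^sup>2"
    using assms by (auto simp: x_def y_def)
  have "(q - s)\<^sup>2 = (x - y)\<^sup>2 * (x + y)\<^sup>2"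
    unfolding xy by (simp add: power_mult_distrib[symmetric] power2_eq_square algebra_simps)
  also have "\<dots> \<le> (x - y)\<^sup>2 * 2\<^sup>2"
    using xy by (intro mult_left_mono power_mono) auto
  finally have "(q - s)\<^sup>2 / 4 \<le> (x - y)\<^sup>2" by simp
  \<comment> \<open>By the identity
    \<open>q - s + (x - y)\<^sup>2 = 2 * x * (x - y)\<close>.\<close>
  then have "q - s + (q - s)\<^sup>2 / 4 \<le> 2 * x * (x - y)"
    unfolding xy by (simp add: power2_eq_square algebra_simps)
  also have "\<dots> \<le> 2 * x\<^sup>2 * (ln x - ln y)"
  proof -
    have "x - y \<le> x * (ln x - ln y)"
      using ln_diff_le[OF xy(3,1)] xy by (simp add: field_simps)
    then have "2 * x * (x - y) \<le> 2 * x * (x * (ln x - ln y))"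
      using xy by (intro mult_left_mono) auto
    then show ?thesis by (simp add: power2_eq_square mult.assoc)
  qed
  also have "\<dots> = q * (ln q - ln s)"
    using xy by (simp add: ln_realpow algebra_simps)
  finally show ?thesis .
qed

lemma norm_le_l1_norm: "norm x \<le> l1_norm x"
  unfolding l1_norm_def by (rule norm_le_l1_cart)

lemma l1_norm_le: "l1_norm (x :: real ^ 'n) \<le> real CARD('n) * norm x"
  unfolding l1_norm_def using sum_bounded_above[of UNIV "\<lambda>i. \<bar>x $ i\<bar>" "norm x"]
  by (simp add: component_le_norm_cart)

lemma l1_norm_triangle: "l1_norm (x + y) \<le> l1_norm x + l1_norm y"
  unfolding l1_norm_def by (simp add: sum.distrib[symmetric] sum_mono abs_triangle_ineq)

lemma norm_cart_le:
  fixes x :: "real ^ 'n"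
  assumes "\<And>i. \<bar>x $ i\<bar> \<le> c"
  shows "norm x \<le> real CARD('n) * c"
proof -
  have "norm x \<le> (\<Sum>i\<in>UNIV. \<bar>x $ i\<bar>)" by (rule norm_le_l1_cart)
  also have "\<dots> \<le> real CARD('n) * c" using sum_bounded_above[of UNIV "\<lambda>i. \<bar>x $ i\<bar>" c] assms by simp
  finally show ?thesis .
qed

lemma norm_sq_cart: "(norm (x :: real ^ 'n))\<^sup>2 = (\<Sum>i\<in>UNIV. (x $ i)\<^sup>2)"
  unfolding power2_norm_eq_inner inner_vec_def by (simp add: power2_eq_square)

text \<open>A Pinsker-type inequality: on summing the scalar bounds, the linear terms cancel because
  both masses are 1.\<close>

lemma kl_div_ge:
  fixes q s :: "real ^ 'n"
  assumes "\<And>i. 0 < q $ i" "\<And>i. 0 < s $ i"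
    and sums: "(\<Sum>i\<in>UNIV. q $ i) = 1" "(\<Sum>i\<in>UNIV. s $ i) = 1"
  shows "(norm (q - s))\<^sup>2 \<le> 4 * kl_div q s"
proof -
  have le1: "x $ i \<le> 1" if "\<And>i. 0 < x $ i" "(\<Sum>i\<in>UNIV. x $ i) = 1" for x :: "real ^ 'n" and i
    using member_le_sum[of i UNIV "\<lambda>i. x $ i"] that by (simp add: less_imp_le)
  have "(\<Sum>i\<in>UNIV. q $ i - s $ i + (q $ i - s $ i)\<^sup>2 / 4) \<le> kl_div q s"
    unfolding kl_div_def using assms le1 by (intro sum_mono kl_term_ge) auto
  then show ?thesis
    using sums by (simp add: sum.distrib sum_subtractf norm_sq_cart sum_divide_distrib[symmetric])
qed

text \<open>The selection rule measures deviation from the line spanned by \<open>q\<close>; for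
  mass 1 this is comparable to the distance to \<open>q\<close> itself. The entries of
  \<open>v\<close> sum to \<open>1 - t\<close>, which bounds the part of \<open>s - q\<close> along
  \<open>q\<close>; conversely, that part is an orthogonal projection of
  \<open>s - q\<close>.\<close>

lemma l1_distance_to_line:
  fixes s q :: "real ^ 'n"
  assumes q: "\<And>i. 0 < q $ i" and sums: "(\<Sum>i\<in>UNIV. q $ i) = 1" "(\<Sum>i\<in>UNIV. s $ i) = 1"
  defines "v \<equiv> s - ((s \<bullet> q) / (norm q)\<^sup>2) *\<^sub>R q"
  shows "norm (s - q) \<le> 2 * l1_norm v"
    and "l1_norm v \<le> 2 * real CARD('n) * norm (s - q)"
proof -
  define t where "t = (s \<bullet> q) / (norm q)\<^sup>2"
  have v: "s - q = v + (t - 1) *\<^sub>R q" by (simp add: v_def t_def algebra_simps)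
  have q1: "l1_norm q = 1" using q sums by (simp add: l1_norm_def less_imp_le abs_of_pos)
  have "q \<noteq> 0" using q[of undefined] by auto
  have "(\<Sum>i\<in>UNIV. v $ i) = 1 - t"
    using sums by (simp add: v_def t_def[symmetric] sum_subtractf sum_distrib_left[symmetric])
  then have t: "\<bar>t - 1\<bar> \<le> l1_norm v"
    unfolding l1_norm_def using sum_abs[of "\<lambda>i. v $ i" UNIV] by (simp add: abs_minus_commute)
  have "norm (s - q) \<le> l1_norm (s - q)" by (rule norm_le_l1_norm)
  also have "\<dots> \<le> l1_norm v + l1_norm ((t - 1) *\<^sub>R q)" unfolding v by (rule l1_norm_triangle)
  also have "l1_norm ((t - 1) *\<^sub>R q) = \<bar>t - 1\<bar> * l1_norm q"
    by (simp add: l1_norm_def abs_mult sum_distrib_left)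
  finally show "norm (s - q) \<le> 2 * l1_norm v" using t q1 by simp
  have "t - 1 = ((s - q) \<bullet> q) / (norm q)\<^sup>2"
    using \<open>q \<noteq> 0\<close> by (simp add: t_def inner_diff_left power2_norm_eq_inner diff_divide_distrib)
  then have "norm ((t - 1) *\<^sub>R q) = \<bar>(s - q) \<bullet> q\<bar> / norm q"
    using \<open>q \<noteq> 0\<close> by (simp add: power2_eq_square)
  also have "\<dots> \<le> norm (s - q)"
    using \<open>q \<noteq> 0\<close> Cauchy_Schwarz_ineq2[of "s - q" q] by (simp add: field_simps)
  finally have "norm v \<le> 2 * norm (s - q)"
    using norm_triangle_ineq4[of "s - q" "(t - 1) *\<^sub>R q"] v by simp
  then have "real CARD('n) * norm v \<le> real CARD('n) * (2 * norm (s - q))"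
    by (intro mult_left_mono) auto
  then show "l1_norm v \<le> 2 * real CARD('n) * norm (s - q)"
    using l1_norm_le[of v] by (simp only: mult.assoc mult.left_commute[of _ 2])
qed

section \<open>Marginals and rescalings\<close>

lemma inner_marginal:
  fixes B :: "('n::finite, 'd::finite) tensor"
  shows "marginal j B \<bullet> v = (\<Sum>m\<in>UNIV. B $ m * v $ (m $ j))"
proof -
  have "marginal j B \<bullet> v = (\<Sum>i\<in>UNIV. \<Sum>m | m \<in> UNIV \<and> m $ j = i. B $ m * v $ (m $ j))"
    by (simp add: marginal_def inner_vec_def sum_distrib_right)
  also have "\<dots> = (\<Sum>m\<in>UNIV. B $ m * v $ (m $ j))"
    by (rule sum.group) auto
  finally show ?thesis .
qed

text \<open>Taking marginals is adjoint to forming separable functions of the multi-index, and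
  log-entries of two scalings differ by such a function. The entropy identities below rest on
  this.\<close>

lemma sum_inner_marginal:
  fixes B :: "('n::finite, 'd::finite) tensor"
  shows "(\<Sum>j\<in>UNIV. marginal j B \<bullet> W $ j) = (\<Sum>m\<in>UNIV. B $ m * (\<Sum>j\<in>UNIV. W $ j $ (m $ j)))"
  unfolding inner_marginal sum_distrib_left by (rule sum.swap)

lemma sum_marginal:
  fixes B :: "('n::finite, 'd::finite) tensor"
  shows "(\<Sum>i\<in>UNIV. marginal j B $ i) = (\<Sum>m\<in>UNIV. B $ m)"
proof -
  have "(\<Sum>i\<in>UNIV. marginal j B $ i) = marginal j B \<bullet> (\<chi> i. 1)"
    by (simp add: inner_vec_def)
  then show ?thesis unfolding inner_marginal by simp
qed

lemma multi_index_through: "\<exists>m :: 'n ^ 'd. m $ j = i"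
  by (rule exI[of _ "\<chi> _. i"]) simp

lemma marginal_ge:
  fixes B :: "('n::finite, 'd::finite) tensor"
  assumes "\<And>m. c \<le> B $ m" "0 \<le> c"
  shows "c \<le> marginal j B $ i"
proof -
  obtain m0 :: "'n ^ 'd" where m0: "m0 $ j = i"
    using multi_index_through[of j i] by (elim exE)
  have "0 \<le> B $ m" for m using assms(2,1) by (rule order_trans)
  then have "B $ m0 \<le> (\<Sum>m | m $ j = i. B $ m)"
    using m0 by (intro member_le_sum) auto
  then show ?thesis using assms(1)[of m0] by (simp add: marginal_def)
qed

lemma marginal_pos:
  fixes B :: "('n::finite, 'd::finite) tensor"
  assumes "\<And>m. 0 < B $ m"
  shows "0 < marginal j B $ i"
  unfolding marginal_def vec_lambda_beta
proof (rule sum_pos)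
  show "{m :: 'n ^ 'd. m $ j = i} \<noteq> {}"
    using multi_index_through[of j i] unfolding ex_in_conv[symmetric] mem_Collect_eq .
qed (use assms in auto)

lemma abs_marginal_diff_le:
  fixes B U :: "('n::finite, 'd::finite) tensor"
  shows "\<bar>marginal j U $ i - marginal j B $ i\<bar> \<le> real CARD('n ^ 'd) * norm (U - B)"
proof -
  have "\<bar>marginal j U $ i - marginal j B $ i\<bar> \<le> (\<Sum>m | m $ j = i. \<bar>(U - B) $ m\<bar>)"
    by (simp add: marginal_def sum_subtractf[symmetric] sum_abs)
  also have "\<dots> \<le> l1_norm (U - B)"
    unfolding l1_norm_def by (intro sum_mono2) auto
  also have "\<dots> \<le> real CARD('n ^ 'd) * norm (U - B)" by (rule l1_norm_le)
  finally show ?thesis .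
qed

lemma tendsto_rescale:
  "(X \<longlongrightarrow> X') F \<Longrightarrow> ((\<lambda>k. rescale A (X k)) \<longlongrightarrow> rescale A X') F"
  unfolding rescale_def by (intro tendsto_intros)

lemma tendsto_marginal:
  "(B \<longlongrightarrow> B') F \<Longrightarrow> ((\<lambda>k. marginal j (B k)) \<longlongrightarrow> marginal j B') F"
  unfolding marginal_def by (intro tendsto_intros)

lemma g_fun_rescale:
  "g_fun A p Y = (\<Sum>m\<in>UNIV. rescale A Y $ m) - (\<Sum>j\<in>UNIV. p $ j \<bullet> Y $ j)"
  by (simp add: g_fun_def rescale_def inner_vec_def mult.commute)

text \<open>Changing one coordinate of a multi-index changes one summand of \<open>\<Sum>j. W $ j $ (m $ j)\<close>.\<close>

lemma coordinate_difference_le: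
  fixes W :: "real ^ 'n ^ 'd"
  assumes "\<And>m :: 'n ^ 'd. \<bar>\<Sum>j\<in>UNIV. W $ j $ (m $ j)\<bar> \<le> t"
  shows "\<bar>W $ j $ i - W $ j $ i'\<bar> \<le> 2 * t"
proof -
  define m :: "'n \<Rightarrow> 'n ^ 'd" where "m h = (\<chi> k. if k = j then h else i')" for h
  have "(\<Sum>k\<in>UNIV. W $ k $ (m h $ k)) = W $ j $ h + (\<Sum>k\<in>UNIV - {j}. W $ k $ i')" for h
    by (subst sum.remove[of _ j]) (auto simp: m_def intro!: sum.cong)
  then show ?thesis using assms[of "m i"] assms[of "m i'"] by (simp add: abs_le_iff)
qed

text \<open>A mass-preserving perturbation \<open>v\<close> does not see additive constants of \<open>w\<close>.\<close>

lemma inner_le_oscillation: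
  fixes v w :: "real ^ 'n"
  assumes "(\<Sum>i\<in>UNIV. v $ i) = 0" "\<And>i i'. \<bar>w $ i - w $ i'\<bar> \<le> t"
  shows "v \<bullet> w \<le> norm v * (real CARD('n) * t)"
proof -
  define c where "c = (\<chi> i :: 'n. w $ undefined)"
  have "v \<bullet> c = 0" using assms(1) by (simp add: c_def inner_vec_def sum_distrib_right[symmetric])
  then have "v \<bullet> w = v \<bullet> (w - c)" by (simp add: inner_diff_right)
  also have "\<dots> \<le> norm v * norm (w - c)" by (rule norm_cauchy_schwarz)
  also have "\<dots> \<le> norm v * (real CARD('n) * t)"
    using assms(2) by (intro mult_left_mono norm_cart_le) (auto simp: c_def)
  finally show ?thesis .
qed

section \<open>Scaling a positive tensor to given marginals\<close>

locale positive_scaling =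
  fixes A :: "('n::finite, 'd::finite) tensor" and p :: "real ^ 'n ^ 'd"
  assumes p_prob: "\<forall>j. p $ j \<in> pos_prob_vectors" and A_positive: "\<forall>m. 0 < A $ m"
begin

lemma p_pos: "0 < p $ j $ i" and p_sum: "(\<Sum>i\<in>UNIV. p $ j $ i) = 1"
  using p_prob by (auto simp: pos_prob_vectors_def)

lemma p_le_1: "p $ j $ i \<le> 1"
  using member_le_sum[of i UNIV "\<lambda>i. p $ j $ i"] p_pos p_sum by (simp add: less_imp_le)

lemma rescale_pos: "0 < rescale A Y $ m"
  using A_positive by (simp add: rescale_def)

lemma ln_rescale_diff:
  "ln (rescale A Y $ m) - ln (rescale A Z $ m) = (\<Sum>j\<in>UNIV. (Y - Z) $ j $ (m $ j))"
  using A_positive by (simp add: rescale_def ln_mult less_imp_neq[symmetric] sum_subtractf)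

lemma mass_of_marginal:
  assumes "marginal j B = p $ j"
  shows "(\<Sum>m\<in>UNIV. B $ m) = 1"
  using p_sum[of j] sum_marginal[of j B] assms by simp

text \<open>The symmetrised relative entropy \<open>\<Sum>m. (U m - V m) (ln U m - ln V m)\<close> of the two
  scalings pairs the marginals with \<open>Y - Z\<close>, hence vanishes.\<close>

lemma scaling_unique:
  assumes "rescale A Y \<in> transport_polytope p" "rescale A Z \<in> transport_polytope p"
  shows "rescale A Y = rescale A Z"
proof -
  let ?U = "rescale A Y" and ?V = "rescale A Z"
  have marg: "marginal j ?U = p $ j" "marginal j ?V = p $ j" for j
    using assms by (auto simp: transport_polytope_def)
  have "(\<Sum>m\<in>UNIV. (?U $ m - ?V $ m) * (ln (?U $ m) - ln (?V $ m))) =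
      (\<Sum>j\<in>UNIV. marginal j ?U \<bullet> (Y - Z) $ j) - (\<Sum>j\<in>UNIV. marginal j ?V \<bullet> (Y - Z) $ j)"
    unfolding sum_inner_marginal ln_rescale_diff by (simp add: left_diff_distrib sum_subtractf)
  also have "\<dots> = 0" by (simp add: marg)
  finally have sum0: "(\<Sum>m\<in>UNIV. (?U $ m - ?V $ m) * (ln (?U $ m) - ln (?V $ m))) = 0" .
  have nonneg: "0 \<le> (?U $ m - ?V $ m) * (ln (?U $ m) - ln (?V $ m))" for m
    by (intro diff_mult_ln_diff_nonneg rescale_pos)
  have "(?U $ m - ?V $ m) * (ln (?U $ m) - ln (?V $ m)) = 0" for m
    using sum0 sum_nonneg_eq_0_iff[of UNIV "\<lambda>m. (?U $ m - ?V $ m) * (ln (?U $ m) - ln (?V $ m))"]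
      nonneg by simp
  then have "?U $ m - ?V $ m = 0 \<or> ln (?U $ m) - ln (?V $ m) = 0" for m
    unfolding mult_eq_0_iff by blast
  then have "?U $ m = ?V $ m" for m
    using rescale_pos[of Y m] rescale_pos[of Z m] ln_inj_iff[of "?U $ m" "?V $ m"] by (smt (verit))
  then show ?thesis by (simp add: vec_eq_iff)
qed

text \<open>The tangent inequality for \<open>exp\<close> is applied entrywise at \<open>Z\<close>.
  Its first-order term pairs with the marginals of \<open>?U\<close>, which are \<open>p\<close>,
  and so matches the linear part of \<open>g_fun\<close>.\<close>

lemma scaling_minimizes:
  assumes "rescale A Z \<in> transport_polytope p"
  shows "is_arg_min (g_fun A p) (\<lambda>Y. True) Z"
proof -
  let ?U = "rescale A Z"
  have marg: "marginal j ?U = p $ j" for j using assms by (auto simp: transport_polytope_def)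
  have "g_fun A p Z \<le> g_fun A p Y" for Y
  proof -
    have "(\<Sum>m\<in>UNIV. ?U $ m) + (\<Sum>j\<in>UNIV. marginal j ?U \<bullet> (Y - Z) $ j) =
        (\<Sum>m\<in>UNIV. ?U $ m * (1 + (ln (rescale A Y $ m) - ln (?U $ m))))"
      unfolding sum_inner_marginal ln_rescale_diff by (simp add: distrib_left sum.distrib)
    also have "\<dots> \<le> (\<Sum>m\<in>UNIV. rescale A Y $ m)"
    proof (rule sum_mono)
      fix m
      show "?U $ m * (1 + (ln (rescale A Y $ m) - ln (?U $ m))) \<le> rescale A Y $ m"
        using ln_diff_le[OF rescale_pos[of Y m] rescale_pos[of Z m]] rescale_pos[of Z m]
        by (simp add: field_simps)
    qed
    finally show ?thesis
      unfolding g_fun_rescale marg by (simp add: inner_diff_right sum_subtractf)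
  qed
  then show ?thesis by (auto simp: is_arg_min_def not_less)
qed

text \<open>Needed for uniqueness of the limit tensor: a statement about all runs singles out a
  tensor only if some run exists.\<close>

lemma sinkhorn_run_exists: "\<exists>X l. sinkhorn_run A p X l"
proof -
  define pick where "pick Y = (SOME j. is_arg_max (deviation p (rescale A Y)) (\<lambda>j. True) j)" for Y
  define next_iterate where "next_iterate Y = (\<chi> j. if j = pick Y
    then Y $ j + log_ratio p j (rescale A Y) else Y $ j)" for Y
  define X where "X k = (next_iterate ^^ k) 0" for k
  have X_rec: "X 0 = 0" "X (Suc k) = next_iterate (X k)" for k by (simp_all add: X_def)
  have "is_arg_max (deviation p (rescale A Y)) (\<lambda>j. True) (pick Y)" for Y
  proof -
    let ?f = "deviation p (rescale A Y)"
    have "Max (range ?f) \<in> range ?f" by (rule Max_in) auto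
    then obtain j where "?f j = Max (range ?f)" by (metis imageE)
    then have "is_arg_max ?f (\<lambda>j. True) j" by (auto simp: is_arg_max_def not_less)
    then show ?thesis unfolding pick_def by (rule someI)
  qed
  then have "sinkhorn_run A p X (\<lambda>k. pick (X k))"
    unfolding sinkhorn_run_def using X_rec by (auto simp: next_iterate_def)
  then show ?thesis by blast
qed

end

section \<open>The Sinkhorn iteration\<close>

locale sinkhorn_iteration = positive_scaling A p
  for A :: "('n::finite, 'd::finite) tensor" and p :: "real ^ 'n ^ 'd" +
  fixes X :: "nat \<Rightarrow> real ^ 'n ^ 'd" and l :: "nat \<Rightarrow> 'd"
  assumes run: "sinkhorn_run A p X l"
begin

abbreviation B where "B k \<equiv> rescale A (X k)"
abbreviation s where "s k j \<equiv> marginal j (B k)"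
abbreviation kl where "kl k \<equiv> kl_div (p $ l k) (s k (l k))"

lemma X_0: "X 0 = 0"
  and X_Suc: "X (Suc k) $ j = (if j = l k then X k $ j + log_ratio p j (B k) else X k $ j)"
  and l_max: "deviation p (B k) j \<le> deviation p (B k) (l k)"
  using run unfolding sinkhorn_run_def is_arg_max_def by (simp_all add: not_less)

lemma s_pos: "0 < s k j $ i"
  by (intro marginal_pos rescale_pos)

lemma B_Suc: "B (Suc k) $ m = exp (log_ratio p (l k) (B k) $ (m $ l k)) * B k $ m"
proof -
  have "(\<Sum>j\<in>UNIV. X (Suc k) $ j $ (m $ j)) =
      (\<Sum>j\<in>UNIV. X k $ j $ (m $ j) + (if j = l k then log_ratio p j (B k) $ (m $ j) else 0))"
    by (intro sum.cong) (simp_all add: X_Suc)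
  also have "\<dots> = (\<Sum>j\<in>UNIV. X k $ j $ (m $ j)) + log_ratio p (l k) (B k) $ (m $ l k)"
    by (simp add: sum.distrib)
  finally show ?thesis by (simp add: rescale_def exp_add)
qed

lemma marginal_updated: "s (Suc k) (l k) = p $ l k"
proof -
  have "s (Suc k) (l k) $ i = p $ l k $ i" for i
  proof -
    have "s (Suc k) (l k) $ i = exp (log_ratio p (l k) (B k) $ i) * s k (l k) $ i"
      by (simp add: marginal_def B_Suc sum_distrib_left)
    also have "\<dots> = p $ l k $ i"
      using p_pos[of "l k" i] s_pos[of "l k" k i] by (simp add: log_ratio_def exp_diff)
    finally show ?thesis .
  qed
  then show ?thesis by (simp add: vec_eq_iff)
qed

text \<open>Every step makes one marginal a probability vector. Nothing of the kind holds at index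
  0, whence the recurring condition \<open>1 \<le> k\<close>.\<close>

lemma mass: "1 \<le> k \<Longrightarrow> (\<Sum>m\<in>UNIV. B k $ m) = 1"
  using mass_of_marginal[OF marginal_updated[of "k - 1"]] by simp

lemma s_sum: "1 \<le> k \<Longrightarrow> (\<Sum>i\<in>UNIV. s k j $ i) = 1"
  by (simp add: sum_marginal mass)

lemma B_le_1: "1 \<le> k \<Longrightarrow> B k $ m \<le> 1"
  using member_le_sum[of m UNIV "\<lambda>m. B k $ m"] mass[of k] rescale_pos by (simp add: less_imp_le)

lemma inner_increment: "p $ j \<bullet> (X (Suc k) $ j - X k $ j) = (if j = l k then kl k else 0)"
  by (simp add: X_Suc log_ratio_def kl_div_def inner_vec_def)

lemma sum_inner_increment: "(\<Sum>j\<in>UNIV. p $ j \<bullet> (X (Suc k) $ j - X k $ j)) = kl k"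
  by (simp add: inner_increment)

lemma kl_ge: "1 \<le> k \<Longrightarrow> (norm (s k (l k) - p $ l k))\<^sup>2 \<le> 4 * kl k"
  using kl_div_ge[of "p $ l k" "s k (l k)"] p_pos s_pos p_sum s_sum by (simp add: norm_minus_commute)

lemma kl_nonneg: "1 \<le> k \<Longrightarrow> 0 \<le> kl k"
  using kl_ge[of k] zero_le_power2[of "norm (s k (l k) - p $ l k)"] by linarith

text \<open>The arg max rule enters here: every deviation is at most that of the chosen mode, and
  the comparison of deviation with distance is used once in each direction.\<close>

lemma marginal_error_le:
  assumes "1 \<le> k"
  shows "norm (s k j - p $ j) \<le> 4 * real CARD('n) * norm (s k (l k) - p $ l k)"
proof -
  note line = l1_distance_to_line[where q = "p $ h" and s = "s k h" for h,
      OF p_pos p_sum s_sum[OF assms], folded deviation_def[of p "B k"]]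
  have "norm (s k j - p $ j) \<le> 2 * deviation p (B k) j" by (rule line(1))
  also have "\<dots> \<le> 2 * deviation p (B k) (l k)" using l_max by simp
  also have "\<dots> \<le> 4 * real CARD('n) * norm (s k (l k) - p $ l k)" using line(2)[of "l k"] by simp
  finally show ?thesis .
qed

lemma marginal_error_sq_le:
  assumes "1 \<le> k"
  shows "(norm (s k j - p $ j))\<^sup>2 \<le> 64 * (real CARD('n))\<^sup>2 * kl k"
proof -
  have "(norm (s k j - p $ j))\<^sup>2 \<le> (4 * real CARD('n) * norm (s k (l k) - p $ l k))\<^sup>2"
    using marginal_error_le[OF assms] by (intro power_mono) auto
  also have "\<dots> = 16 * (real CARD('n))\<^sup>2 * (norm (s k (l k) - p $ l k))\<^sup>2"
    by (simp add: power_mult_distrib)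
  also have "\<dots> \<le> 16 * (real CARD('n))\<^sup>2 * (4 * kl k)"
    using kl_ge[OF assms] by (intro mult_left_mono) auto
  finally show ?thesis by simp
qed

text \<open>The updated \<open>x\<^sub>j\<close> equals \<open>ln p\<^sub>j\<close> minus the logarithm of a vector whose entries are sums
  of the same weights against entries of \<open>A\<close>; so it oscillates no more than \<open>ln p\<^sub>j\<close> and
  \<open>ln A\<close> together.\<close>

lemma oscillation_bounded: "\<exists>R. \<forall>k j i i'. X k $ j $ i - X k $ j $ i' \<le> R"
proof -
  define a where "a = Min (range (($) A))"
  define b where "b = Max (range (($) A))"
  define q where "q = Min (range (\<lambda>(j, i). p $ j $ i))"
  have a: "0 < a" "a \<le> A $ m" and b: "A $ m \<le> b" for m
    using A_positive by (auto simp: a_def b_def)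
  have q: "0 < q" using p_pos by (auto simp: q_def)
  have q_le: "q \<le> p $ j $ i" for j i
    unfolding q_def by (rule Min_le) (auto intro: image_eqI[of _ _ "(j, i)"])
  define R where "R = ln b - ln a - ln q"
  have "a \<le> b" using a(2)[of undefined] b[of undefined] by simp
  have "q \<le> 1" using q_le p_le_1 order_trans by blast
  have "ln a \<le> ln b" "ln q \<le> 0" using \<open>a \<le> b\<close> \<open>q \<le> 1\<close> a(1) q by auto
  then have "0 \<le> R" by (simp add: R_def)
  have "X k $ j $ i - X k $ j $ i' \<le> R" for k j i i'
  proof (induction k)
    case 0
    then show ?case using \<open>0 \<le> R\<close> by (simp add: X_0)
  next
    case (Suc k)
    show ?case
    proof (cases "j = l k")
      case True
      \<comment> \<open>\<open>E m\<close> collects the scaling factors of the other modes and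
        ignores \<open>m $ j\<close>; hence its slice sums \<open>T\<close> are constant, by moving
        one slice onto another.\<close>
      define E where "E m = exp (\<Sum>h\<in>UNIV - {j}. X k $ h $ (m $ h))" for m
      define T where "T i = (\<Sum>m | m $ j = i. E m)" for i
      have T_eq: "T i = T i'"
        unfolding T_def
      proof (rule sum.reindex_bij_witness[where
            i = "\<lambda>m. \<chi> h. if h = j then i else m $ h" and j = "\<lambda>m. \<chi> h. if h = j then i' else m $ h"])
        show "E (\<chi> h. if h = j then i' else m $ h) = E m" for m
          unfolding E_def by (intro arg_cong[where f = exp] sum.cong) auto
      qed (auto simp: vec_eq_iff)
      have "0 < T i'"
        using marginal_pos[of "\<chi> m. E m" j i'] by (simp add: T_def marginal_def E_def)
      have B_eq: "B k $ m = exp (X k $ j $ (m $ j)) * (A $ m * E m)" for m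
        unfolding rescale_def E_def by (simp add: sum.remove[of UNIV j] exp_add)
      have s_eq: "s k j $ h = exp (X k $ j $ h) * (\<Sum>m | m $ j = h. A $ m * E m)" for h
        by (simp add: marginal_def B_eq sum_distrib_left)
      have E_pos: "0 < E m" for m by (simp add: E_def)
      \<comment> \<open>The old value of this mode cancels: the update depends on the other modes
        only.\<close>
      have new: "X (Suc k) $ j $ h = ln (p $ j $ h) - ln (\<Sum>m | m $ j = h. A $ m * E m)" for h
      proof -
        have "0 < (\<Sum>m | m $ j = h. A $ m * E m)"
          using marginal_pos[of "\<chi> m. A $ m * E m" j h] A_positive E_pos by (simp add: marginal_def)
        then show ?thesis using True by (simp add: X_Suc log_ratio_def s_eq[unfolded True] ln_mult)
      qed
      \<comment> \<open>The slice sums weighted by \<open>A\<close> lie between \<open>a\<close> and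
        \<open>b\<close> times the same number, which drops out of the difference of
        logarithms.\<close>
      have "a * T i \<le> (\<Sum>m | m $ j = i. A $ m * E m)"
        unfolding T_def sum_distrib_left
        using a E_pos by (intro sum_mono mult_right_mono) (auto simp: less_imp_le)
      then have "ln (a * T i') \<le> ln (\<Sum>m | m $ j = i. A $ m * E m)"
        using a \<open>0 < T i'\<close> unfolding T_eq by (intro ln_mono) auto
      moreover have "(\<Sum>m | m $ j = i'. A $ m * E m) \<le> b * T i'"
        unfolding T_def sum_distrib_left
        using b E_pos by (intro sum_mono mult_right_mono) (auto simp: less_imp_le)
      then have "ln (\<Sum>m | m $ j = i'. A $ m * E m) \<le> ln (b * T i')"
        using marginal_pos[of "\<chi> m. A $ m * E m" j i'] A_positive E_pos
        by (intro ln_mono) (auto simp: marginal_def)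
      moreover have "ln (p $ j $ i) \<le> 0" using p_pos p_le_1 by simp
      moreover have "ln q \<le> ln (p $ j $ i')" using q q_le by (intro ln_mono) auto
      ultimately show ?thesis
        unfolding new R_def using a(1) \<open>a \<le> b\<close> \<open>0 < T i'\<close> by (simp add: ln_mult)
    next
      case False
      then show ?thesis using Suc by (simp add: X_Suc)
    qed
  qed
  then show ?thesis by blast
qed

text \<open>The means \<open>\<langle>p\<^sub>j, x\<^sub>j\<rangle>\<close> increase, which together with bounded oscillation bounds
  every coordinate from below; the entries of \<open>B k\<close> are at most 1, which bounds the sums of
  coordinates from above.\<close>

lemma X_bounded: "\<exists>C. \<forall>k\<ge>1. \<forall>j i. \<bar>X k $ j $ i\<bar> \<le> C"
proof -
  obtain R where R: "\<And>k j i i'. X k $ j $ i - X k $ j $ i' \<le> R"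
    using oscillation_bounded by blast
  define a where "a = Min (range (($) A))"
  have a: "0 < a" "a \<le> A $ m" for m using A_positive by (auto simp: a_def)
  define L where "L = (\<Sum>j\<in>UNIV. \<bar>p $ j \<bullet> X 1 $ j\<bar>) + \<bar>R\<bar>"
  have lower: "- L \<le> X k $ j $ i" if "1 \<le> k" for k j i
  proof -
    \<comment> \<open>The comparison starts at index 1, since the first divergence, taken against an
      unnormalised marginal, may be negative.\<close>
    have "p $ j \<bullet> X 1 $ j \<le> p $ j \<bullet> X k $ j"
      using that
    proof (induction k rule: dec_induct)
      case (step k)
      have "0 \<le> p $ j \<bullet> (X (Suc k) $ j - X k $ j)"
        using kl_nonneg[OF step(1)] by (simp add: inner_increment)
      then show ?case using step.IH by (simp add: inner_diff_right)
    qed simp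
    \<comment> \<open>A \<open>p $ j\<close>-average exceeds any single coordinate by at most the
      oscillation.\<close>
    also have "\<dots> \<le> (\<Sum>h\<in>UNIV. p $ j $ h * (X k $ j $ i + R))"
      unfolding inner_vec_def
    proof (intro sum_mono)
      fix h
      have "X k $ j $ h \<le> X k $ j $ i + R" using R[of k j h i] by simp
      then show "p $ j $ h \<bullet> X k $ j $ h \<le> p $ j $ h * (X k $ j $ i + R)"
        using p_pos[of j h] by (simp add: mult_left_mono)
    qed
    also have "\<dots> = X k $ j $ i + R" by (simp add: sum_distrib_right[symmetric] p_sum)
    finally have "p $ j \<bullet> X 1 $ j - R \<le> X k $ j $ i" by simp
    moreover have "\<bar>p $ j \<bullet> X 1 $ j\<bar> \<le> (\<Sum>j\<in>UNIV. \<bar>p $ j \<bullet> X 1 $ j\<bar>)"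
      by (intro member_le_sum) auto
    ultimately show ?thesis unfolding L_def by linarith
  qed
  define C where "C = \<bar>ln a\<bar> + real CARD('d) * \<bar>L\<bar>"
  have "0 \<le> C" by (simp add: C_def)
  have upper: "X k $ j $ i \<le> C" if "1 \<le> k" for k j i
  proof -
    \<comment> \<open>At the constant multi-index, \<open>ln (B k $ m) \<le> 0\<close> bounds the
      sum of the \<open>i\<close>-th coordinates over all modes; the lower bound on the other modes
      then isolates mode \<open>j\<close>.\<close>
    define m :: "'n ^ 'd" where "m = (\<chi> _. i)"
    have "ln (B k $ m) \<le> 0" using B_le_1[OF that] rescale_pos[of "X k" m] by simp
    then have "ln (A $ m) + (\<Sum>h\<in>UNIV. X k $ h $ i) \<le> 0"
      using A_positive[rule_format, of m] by (simp add: rescale_def ln_mult m_def)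
    moreover have "ln a \<le> ln (A $ m)" using a by (intro ln_mono) auto
    moreover have "(\<Sum>h\<in>UNIV. X k $ h $ i) = X k $ j $ i + (\<Sum>h\<in>UNIV - {j}. X k $ h $ i)"
      by (simp add: sum.remove)
    moreover have "- (real CARD('d) * \<bar>L\<bar>) \<le> (\<Sum>h\<in>UNIV - {j}. X k $ h $ i)"
    proof -
      have "(\<Sum>h\<in>UNIV - {j}. - \<bar>L\<bar>) \<le> (\<Sum>h\<in>UNIV - {j}. X k $ h $ i)"
        using lower[OF that] abs_ge_self[of L] by (intro sum_mono) (smt (verit))
      moreover have "real (card (UNIV - {j})) * \<bar>L\<bar> \<le> real CARD('d) * \<bar>L\<bar>"
        by (intro mult_right_mono) (auto intro: card_mono)
      ultimately show ?thesis by (simp del: card_Diff_singleton)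
    qed
    ultimately show ?thesis unfolding C_def by linarith
  qed
  have "\<bar>X k $ j $ i\<bar> \<le> C + \<bar>L\<bar>" if "1 \<le> k" for k j i
    using lower[OF that, of j i] upper[OF that, of j i] \<open>0 \<le> C\<close> by linarith
  then show ?thesis by blast
qed

section \<open>Vanishing divergences and limit points of the iterates\<close>

lemma sum_inner_increment_gap:
  "(\<Sum>j\<in>UNIV. p $ j \<bullet> (Z - X (Suc k)) $ j) = (\<Sum>j\<in>UNIV. p $ j \<bullet> (Z - X k) $ j) - kl k"
  unfolding sum_inner_increment[symmetric] by (simp add: inner_diff_right sum_subtractf)

text \<open>The divergences are the increments of an increasing sequence that is bounded because the
  iterates are.\<close>

lemma kl_tendsto_0: "(\<lambda>k. kl (Suc k)) \<longlonglongrightarrow> 0"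
proof -
  obtain C where C: "\<And>k j i. 1 \<le> k \<Longrightarrow> \<bar>X k $ j $ i\<bar> \<le> C" using X_bounded by blast
  define f where "f k = (\<Sum>j\<in>UNIV. p $ j \<bullet> X (Suc k) $ j)" for k
  have f_Suc: "f (Suc k) - f k = kl (Suc k)" for k
    unfolding f_def sum_inner_increment[symmetric] by (simp add: inner_diff_right sum_subtractf)
  have "incseq f"
    using f_Suc kl_nonneg by (intro incseq_SucI) (metis diff_ge_0_iff_ge le_add1 plus_1_eq_Suc)
  moreover have "f k \<le> (\<Sum>j\<in>(UNIV :: 'd set). C)" for k
    unfolding f_def
  proof (rule sum_mono)
    fix j
    have "p $ j \<bullet> X (Suc k) $ j \<le> (\<Sum>i\<in>UNIV. p $ j $ i * C)"
      unfolding inner_vec_def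
    proof (rule sum_mono)
      fix i
      have "X (Suc k) $ j $ i \<le> C" using C[of "Suc k" j i] by simp
      then show "p $ j $ i \<bullet> X (Suc k) $ j $ i \<le> p $ j $ i * C"
        using p_pos[of j i] by (simp add: mult_left_mono)
    qed
    then show "p $ j \<bullet> X (Suc k) $ j \<le> C" by (simp add: sum_distrib_right[symmetric] p_sum)
  qed
  ultimately obtain L where L: "f \<longlonglongrightarrow> L" using incseq_convergent by blast
  have "(\<lambda>k. f (Suc k) - f k) \<longlonglongrightarrow> L - L" by (intro tendsto_diff LIMSEQ_Suc L)
  then show ?thesis by (simp add: f_Suc)
qed

lemma marginals_converge: "(\<lambda>k. s (Suc k) j) \<longlonglongrightarrow> p $ j"
proof -
  have lim: "(\<lambda>k. sqrt (64 * (real CARD('n))\<^sup>2 * kl (Suc k))) \<longlonglongrightarrow> 0"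
    using tendsto_real_sqrt[OF tendsto_mult_right_zero[OF kl_tendsto_0]] by simp
  have "norm (s (Suc k) j - p $ j) \<le> sqrt (64 * (real CARD('n))\<^sup>2 * kl (Suc k))" for k
    using marginal_error_sq_le[of "Suc k" j] by (intro real_le_rsqrt) simp
  then have "(\<lambda>k. s (Suc k) j - p $ j) \<longlonglongrightarrow> 0"
    by (rule Lim_null_comparison[OF always_eventually[OF allI] lim])
  then show ?thesis by (simp add: LIM_zero_iff)
qed

text \<open>Compactness yields the subsequence; continuity of scaling and marginals passes the
  limiting marginals on to \<open>Z\<close>.\<close>

lemma accumulation_point:
  obtains f Z where "strict_mono f" "((\<lambda>k. X (Suc k)) \<circ> f) \<longlonglongrightarrow> Z"
    "rescale A Z \<in> transport_polytope p"
proof -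
  obtain C where C: "\<And>k j i. 1 \<le> k \<Longrightarrow> \<bar>X k $ j $ i\<bar> \<le> C" using X_bounded by blast
  have "norm (X (Suc k)) \<le> (\<Sum>j\<in>(UNIV :: 'd set). real CARD('n) * C)" for k
  proof -
    have "norm (X (Suc k)) \<le> (\<Sum>j\<in>UNIV. norm (X (Suc k) $ j))"
      unfolding norm_vec_def by (rule L2_set_le_sum) simp
    also have "\<dots> \<le> (\<Sum>j\<in>(UNIV :: 'd set). real CARD('n) * C)"
      using C by (intro sum_mono norm_cart_le) simp
    finally show ?thesis .
  qed
  then have "bounded (range (\<lambda>k. X (Suc k)))" by (auto intro!: boundedI)
  then obtain Z f where f: "strict_mono f" "((\<lambda>k. X (Suc k)) \<circ> f) \<longlonglongrightarrow> Z"
    using bounded_imp_convergent_subsequence by blast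
  have "marginal j (rescale A Z) = p $ j" for j
  proof (rule LIMSEQ_unique)
    show "(\<lambda>k. s (Suc (f k)) j) \<longlonglongrightarrow> marginal j (rescale A Z)"
      using f(2) by (intro tendsto_marginal tendsto_rescale) (simp add: o_def)
    show "(\<lambda>k. s (Suc (f k)) j) \<longlonglongrightarrow> p $ j"
      using LIMSEQ_subseq_LIMSEQ[OF marginals_converge f(1)] by (simp add: o_def)
  qed
  then have "rescale A Z \<in> transport_polytope p"
    using rescale_pos by (auto simp: transport_polytope_def less_imp_le)
  then show ?thesis using that f by blast
qed

lemma B_bounded_below: "\<exists>c>0. \<forall>k\<ge>1. \<forall>m. c \<le> B k $ m"
proof -
  obtain C where C: "\<And>k j i. 1 \<le> k \<Longrightarrow> \<bar>X k $ j $ i\<bar> \<le> C" using X_bounded by blast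
  define a where "a = Min (range (($) A))"
  have a: "0 < a" "a \<le> A $ m" for m using A_positive by (auto simp: a_def)
  have "exp (real CARD('d) * (- C)) * a \<le> B k $ m" if "1 \<le> k" for k m
  proof -
    have "(\<Sum>j\<in>(UNIV :: 'd set). - C) \<le> (\<Sum>j\<in>UNIV. X k $ j $ (m $ j))"
      using C[OF that] by (intro sum_mono) (simp add: abs_le_iff minus_le_iff)
    then show ?thesis using a by (simp add: rescale_def mult_mono less_imp_le)
  qed
  moreover have "0 < exp (real CARD('d) * (- C)) * a" using a by simp
  ultimately show ?thesis by blast
qed

end

section \<open>Rate of convergence towards a fixed limit scaling\<close>

locale sinkhorn_limit = sinkhorn_iteration A p X l
  for A :: "('n::finite, 'd::finite) tensor" and p :: "real ^ 'n ^ 'd" and X l +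
  fixes Z :: "real ^ 'n ^ 'd" and c :: real
  assumes Z: "rescale A Z \<in> transport_polytope p"
    and c_pos: "0 < c" and c_le_B: "1 \<le> k \<Longrightarrow> c \<le> rescale A (X k) $ m" and c_le_U: "c \<le> rescale A Z $ m"
begin

abbreviation U where "U \<equiv> rescale A Z"

definition gap where "gap k = (\<Sum>j\<in>UNIV. p $ j \<bullet> (Z - X k) $ j)"

lemma U_marginal: "marginal j U = p $ j"
  using Z by (simp add: transport_polytope_def)

lemma U_mass: "(\<Sum>m\<in>UNIV. U $ m) = 1"
  by (rule mass_of_marginal[OF U_marginal])

lemma U_le_1: "U $ m \<le> 1"
  using member_le_sum[of m UNIV "\<lambda>m. U $ m"] U_mass rescale_pos by (simp add: less_imp_le)

lemma c_le_p: "c \<le> p $ j $ i"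
  using marginal_ge[of c U j i] c_le_U c_pos U_marginal by simp

lemma c_le_s: "1 \<le> k \<Longrightarrow> c \<le> s k j $ i"
  using marginal_ge[of c "B k" j i] c_le_B c_pos by simp

text \<open>The gap \<open>g (X k) - g Z\<close> is the relative entropy of \<open>U\<close> with respect to \<open>B k\<close>.\<close>

lemma gap_eq: "gap k = (\<Sum>m\<in>UNIV. U $ m * (ln (U $ m) - ln (B k $ m)))"
  unfolding gap_def ln_rescale_diff sum_inner_marginal[symmetric] by (simp add: U_marginal)

text \<open>Gibbs' inequality: the entrywise lower bounds sum to the difference of the masses, both
  of which are 1.\<close>

lemma gap_nonneg:
  assumes "1 \<le> k"
  shows "0 \<le> gap k"
proof -
  have "(\<Sum>m\<in>UNIV. U $ m - B k $ m) \<le> gap k"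
    unfolding gap_eq
  proof (rule sum_mono)
    fix m
    show "U $ m - B k $ m \<le> U $ m * (ln (U $ m) - ln (B k $ m))"
      using ln_diff_le[OF rescale_pos[of "X k" m] rescale_pos[of Z m]] rescale_pos[of Z m]
      by (simp add: field_simps)
  qed
  then show ?thesis using mass[OF assms] U_mass by (simp add: sum_subtractf)
qed

text \<open>With \<open>t = ln U - ln B\<close>, the symmetrised entropy \<open>J = \<Sum>m. (U m - B m) t m\<close> dominates
  both the gap and \<open>c \<parallel>t\<parallel>\<^sup>2\<close>, while pairing marginals gives \<open>J \<le> Q \<parallel>t\<parallel>\<close> with \<open>Q\<close>
  proportional to the marginal error. Hence the gap is at most quadratic in that error.\<close>

lemma gap_le_error:
  assumes k: "1 \<le> k" and E: "\<And>j. norm (s k j - p $ j) \<le> E"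
  shows "gap k \<le> (2 * real CARD('d) * real CARD('n) * E)\<^sup>2 / c"
proof -
  define t where "t = (\<chi> m. ln (U $ m) - ln (B k $ m))"
  define J where "J = (\<Sum>m\<in>UNIV. (U $ m - B k $ m) * t $ m)"
  define Q where "Q = 2 * real CARD('d) * real CARD('n) * E"
  have t_eq: "t $ m = (\<Sum>j\<in>UNIV. (Z - X k) $ j $ (m $ j))" for m
    by (simp add: t_def ln_rescale_diff)
  \<comment> \<open>The right-hand side is zero, so subtracting the left-hand sum from the gap can
    only enlarge it; the result is \<open>J\<close>.\<close>
  have "(\<Sum>m\<in>UNIV. B k $ m * t $ m) \<le> (\<Sum>m\<in>UNIV. U $ m - B k $ m)"
  proof (rule sum_mono)
    fix m
    show "B k $ m * t $ m \<le> U $ m - B k $ m"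
      using ln_diff_le[OF rescale_pos[of Z m] rescale_pos[of "X k" m]] rescale_pos[of "X k" m]
      by (simp add: t_def field_simps)
  qed
  then have gap_le_J: "gap k \<le> J"
    using mass[OF k] U_mass
    by (simp add: gap_eq J_def t_def[symmetric] left_diff_distrib sum_subtractf)
      (simp add: t_def)
  have "c * (norm t)\<^sup>2 \<le> J"
    unfolding norm_sq_cart sum_distrib_left J_def
  proof (rule sum_mono)
    fix m
    have "\<bar>t $ m\<bar> \<le> \<bar>U $ m - B k $ m\<bar> / c"
      unfolding t_def using abs_ln_diff_le[OF c_pos c_le_U c_le_B[OF k]] by simp
    then have "c * \<bar>t $ m\<bar> \<le> \<bar>U $ m - B k $ m\<bar>" using c_pos by (simp add: field_simps)
    then have "c * \<bar>t $ m\<bar> * \<bar>t $ m\<bar> \<le> \<bar>U $ m - B k $ m\<bar> * \<bar>t $ m\<bar>"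
      by (intro mult_right_mono) auto
    also have "\<dots> = (U $ m - B k $ m) * t $ m"
      using diff_mult_ln_diff_nonneg[OF rescale_pos[of Z m] rescale_pos[of "X k" m]]
      by (simp add: abs_mult[symmetric] t_def)
    finally show "c * (t $ m)\<^sup>2 \<le> (U $ m - B k $ m) * t $ m"
      by (simp add: power2_eq_square mult.assoc abs_mult_self_eq)
  qed
  moreover have J_le: "J \<le> Q * norm t"
  proof -
    have "J = (\<Sum>j\<in>UNIV. (p $ j - s k j) \<bullet> (Z - X k) $ j)"
      unfolding J_def t_eq
      by (simp only: left_diff_distrib sum_subtractf sum_inner_marginal[symmetric]
          inner_diff_left U_marginal)
    also have "\<dots> \<le> (\<Sum>j\<in>(UNIV :: 'd set). E * (real CARD('n) * (2 * norm t)))"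
    proof (rule sum_mono)
      fix j
      \<comment> \<open>\<open>t\<close> determines the vectors of \<open>Z - X k\<close> only up to
        constants shifted between modes. Oscillation suffices, as the marginal errors have total
        mass 0.\<close>
      have "\<bar>(Z - X k) $ j $ i - (Z - X k) $ j $ i'\<bar> \<le> 2 * norm t" for i i'
        by (rule coordinate_difference_le) (metis t_eq component_le_norm_cart)
      moreover have "(\<Sum>i\<in>UNIV. (p $ j - s k j) $ i) = 0"
        by (simp add: sum_subtractf p_sum s_sum[OF k])
      ultimately have "(p $ j - s k j) \<bullet> (Z - X k) $ j
          \<le> norm (p $ j - s k j) * (real CARD('n) * (2 * norm t))"
        by (intro inner_le_oscillation)
      also have "\<dots> \<le> E * (real CARD('n) * (2 * norm t))"
        using E[of j] by (intro mult_right_mono) (auto simp: norm_minus_commute)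
      finally show "(p $ j - s k j) \<bullet> (Z - X k) $ j \<le> E * (real CARD('n) * (2 * norm t))" .
    qed
    also have "\<dots> = Q * norm t" by (simp add: Q_def)
    finally show ?thesis .
  qed
  ultimately have "c * norm t * norm t \<le> Q * norm t" by (simp add: power2_eq_square)
  moreover have "0 \<le> E" using norm_ge_zero E order_trans by blast
  then have "0 \<le> Q" by (simp add: Q_def)
  ultimately have "c * norm t \<le> Q" by (cases "norm t = 0") auto
  then have "norm t \<le> Q / c" using c_pos by (simp add: field_simps)
  then have "Q * norm t \<le> Q * (Q / c)" using \<open>0 \<le> Q\<close> by (intro mult_left_mono)
  then show ?thesis using gap_le_J J_le by (simp add: Q_def power2_eq_square)
qed

lemma gap_Suc: "gap (Suc k) = gap k - kl k"
  unfolding gap_def by (rule sum_inner_increment_gap)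

text \<open>Each step lowers the gap by \<open>kl k\<close>, which is at least the fraction
  \<open>1 / K\<close> of it.\<close>

lemma gap_geometric: "\<exists>K r. 0 < r \<and> r < 1 \<and> (\<forall>k. gap (Suc k) \<le> K * r ^ k)"
proof -
  \<comment> \<open>Inserting the error bound \<open>8 * n * sqrt (kl k)\<close> into the quadratic
    estimate gives \<open>4 * 64 = 256\<close>; the added 1 makes the ratio \<open>1 - 1 / K\<close>
    positive.\<close>
  define K where "K = 256 * (real CARD('d))\<^sup>2 * (real CARD('n))^4 / c + 1"
  have "1 < K" using c_pos by (simp add: K_def)
  have gap_le: "gap k \<le> K * kl k" if "1 \<le> k" for k
  proof -
    let ?E = "8 * real CARD('n) * sqrt (kl k)"
    have E_sq: "?E\<^sup>2 = 64 * (real CARD('n))\<^sup>2 * kl k"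
      using kl_nonneg[OF that] unfolding power_mult_distrib by simp
    have "norm (s k j - p $ j) \<le> ?E" for j
    proof (rule power2_le_imp_le)
      show "(norm (s k j - p $ j))\<^sup>2 \<le> ?E\<^sup>2"
        unfolding E_sq by (rule marginal_error_sq_le[OF that])
    qed (use kl_nonneg[OF that] in simp)
    then have "gap k \<le> (2 * real CARD('d) * real CARD('n) * ?E)\<^sup>2 / c" by (rule gap_le_error[OF that])
    also have "\<dots> = (K - 1) * kl k"
      unfolding power_mult_distrib[of _ ?E] E_sq K_def
      by (simp add: power_mult_distrib power4_eq_xxxx power2_eq_square)
    also have "\<dots> \<le> K * kl k" using kl_nonneg[OF that] by (intro mult_right_mono) auto
    finally show ?thesis .
  qed
  define r where "r = 1 - 1 / K"
  have r: "0 < r" "r < 1" using \<open>1 < K\<close> by (simp_all add: r_def)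
  have "gap (Suc k) \<le> gap 1 * r ^ k" for k
  proof (induction k)
    case (Suc k)
    have "gap (Suc k) / K \<le> kl (Suc k)"
      using gap_le[of "Suc k"] \<open>1 < K\<close> by (simp add: field_simps)
    then have "gap (Suc (Suc k)) \<le> r * gap (Suc k)"
      unfolding gap_Suc[of "Suc k"] r_def by (simp add: left_diff_distrib)
    also have "\<dots> \<le> r * (gap 1 * r ^ k)" using Suc r by (intro mult_left_mono) auto
    finally show ?case by (simp add: mult.left_commute)
  qed simp
  then show ?thesis using r by blast
qed

text \<open>Only one mode moves, by a log ratio; \<open>ln\<close> is Lipschitz with constant
  \<open>1 / c\<close> above \<open>c\<close>, and the marginal error is at most
  \<open>2 * sqrt (kl k)\<close>.\<close>

lemma step_le:
  assumes "1 \<le> k"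
  shows "norm (X (Suc k) - X k) \<le> 2 * real CARD('n) / c * sqrt (kl k)"
proof -
  let ?e = "norm (s k (l k) - p $ l k)"
  have "norm (X (Suc k) - X k) \<le> (\<Sum>j\<in>UNIV. norm ((X (Suc k) - X k) $ j))"
    unfolding norm_vec_def by (rule L2_set_le_sum) simp
  also have "\<dots> = (\<Sum>j\<in>UNIV. if j = l k then norm (log_ratio p j (B k)) else 0)"
    by (intro sum.cong) (simp_all add: X_Suc)
  also have "\<dots> = norm (log_ratio p (l k) (B k))" by simp
  also have "\<dots> \<le> real CARD('n) * (?e / c)"
  proof (rule norm_cart_le)
    fix i
    have "\<bar>log_ratio p (l k) (B k) $ i\<bar> \<le> \<bar>p $ l k $ i - s k (l k) $ i\<bar> / c"
      unfolding log_ratio_def using abs_ln_diff_le[OF c_pos c_le_p c_le_s[OF assms]] by simp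
    also have "\<bar>p $ l k $ i - s k (l k) $ i\<bar> \<le> ?e"
      using component_le_norm_cart[of "s k (l k) - p $ l k" i] by (simp add: abs_minus_commute)
    finally show "\<bar>log_ratio p (l k) (B k) $ i\<bar> \<le> ?e / c"
      using c_pos by (simp add: divide_right_mono)
  qed
  also have "\<dots> \<le> real CARD('n) * (2 * sqrt (kl k) / c)"
  proof -
    have "?e \<le> sqrt (4 * kl k)" by (rule real_le_rsqrt[OF kl_ge[OF assms]])
    also have "\<dots> = 2 * sqrt (kl k)" by (simp add: real_sqrt_mult)
    finally show ?thesis using c_pos by (intro mult_left_mono divide_right_mono) auto
  qed
  finally show ?thesis by (simp add: mult_ac)
qed

text \<open>A divergence is a drop between nonnegative gaps, hence at most the earlier gap. Steps
  are bounded by its square root, whence the ratio \<open>sqrt r\<close>.\<close>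

lemma steps_geometric:
  "\<exists>K r. 0 < r \<and> r < 1 \<and> (\<forall>k. norm (X (Suc (Suc k)) - X (Suc k)) \<le> K * r ^ k)"
proof -
  obtain K r where r: "0 < r" "r < 1" and K: "\<And>k. gap (Suc k) \<le> K * r ^ k"
    using gap_geometric by blast
  have "norm (X (Suc (Suc k)) - X (Suc k)) \<le> (2 * real CARD('n) / c * sqrt K) * sqrt r ^ k" for k
  proof -
    have "kl (Suc k) \<le> K * r ^ k"
      using K[of k] gap_nonneg[of "Suc (Suc k)"] gap_Suc[of "Suc k"] by simp
    then have "sqrt (kl (Suc k)) \<le> sqrt K * sqrt r ^ k"
      using real_sqrt_le_mono by (fastforce simp: real_sqrt_mult real_sqrt_power)
    then have "2 * real CARD('n) / c * sqrt (kl (Suc k)) \<le> 2 * real CARD('n) / c * (sqrt K * sqrt r ^ k)"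
      using c_pos by (intro mult_left_mono) auto
    then show ?thesis using step_le[of "Suc k"] by (simp add: mult.assoc)
  qed
  moreover have "0 < sqrt r" "sqrt r < 1" using r by auto
  ultimately show ?thesis by blast
qed

text \<open>Entries in (0, 1] differ by no more than their logarithms, and the logarithms differ
  linearly in \<open>X k - Z\<close>.\<close>

lemma tensor_error_le:
  assumes "1 \<le> k"
  shows "norm (B k - U) \<le> real CARD('n ^ 'd) * (real CARD('d) * norm (X k - Z))"
proof (rule norm_cart_le)
  fix m
  have "\<bar>(B k - U) $ m\<bar> \<le> \<bar>ln (B k $ m) - ln (U $ m)\<bar>"
    using abs_diff_le_ln[OF rescale_pos B_le_1[OF assms] rescale_pos U_le_1] by simp
  also have "\<dots> \<le> (\<Sum>j\<in>UNIV. \<bar>(X k - Z) $ j $ (m $ j)\<bar>)"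
    unfolding ln_rescale_diff by (rule sum_abs)
  also have "\<dots> \<le> (\<Sum>j\<in>(UNIV :: 'd set). norm (X k - Z))"
  proof (rule sum_mono)
    fix j
    show "\<bar>(X k - Z) $ j $ (m $ j)\<bar> \<le> norm (X k - Z)"
      by (rule order_trans[OF component_le_norm_cart Finite_Cartesian_Product.norm_nth_le])
  qed
  finally show "\<bar>(B k - U) $ m\<bar> \<le> real CARD('d) * norm (X k - Z)" by simp
qed

lemma kl_le_tensor_error:
  assumes "1 \<le> k"
  shows "\<bar>kl_div (p $ j) (s k j)\<bar> \<le> real CARD('n) * (real CARD('n ^ 'd) / c) * norm (B k - U)"
proof -
  have "\<bar>kl_div (p $ j) (s k j)\<bar> \<le> (\<Sum>i\<in>UNIV. \<bar>p $ j $ i * (ln (p $ j $ i) - ln (s k j $ i))\<bar>)"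
    unfolding kl_div_def by (rule sum_abs)
  also have "\<dots> \<le> (\<Sum>i\<in>(UNIV :: 'n set). real CARD('n ^ 'd) * norm (U - B k) / c)"
  proof (rule sum_mono)
    fix i
    have "\<bar>p $ j $ i * (ln (p $ j $ i) - ln (s k j $ i))\<bar> \<le> \<bar>ln (p $ j $ i) - ln (s k j $ i)\<bar>"
      using p_pos[of j i] p_le_1[of j i] by (simp add: abs_mult mult_left_le_one_le)
    also have "\<dots> \<le> \<bar>p $ j $ i - s k j $ i\<bar> / c"
      by (rule abs_ln_diff_le[OF c_pos c_le_p c_le_s[OF assms]])
    also have "\<dots> \<le> real CARD('n ^ 'd) * norm (U - B k) / c"
      using abs_marginal_diff_le[of j U i "B k"] c_pos
      unfolding U_marginal by (intro divide_right_mono) auto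
    finally show "\<bar>p $ j $ i * (ln (p $ j $ i) - ln (s k j $ i))\<bar>
      \<le> real CARD('n ^ 'd) * norm (U - B k) / c" .
  qed
  finally show ?thesis by (simp add: norm_minus_commute)
qed

lemma tensors_converge:
  assumes "converges_geometrically (\<lambda>k. X (Suc k)) Z"
  shows "converges_geometrically (\<lambda>k. B (Suc k)) U"
  by (rule converges_geometrically_compare[OF assms,
        where C = "real CARD('n ^ 'd) * real CARD('d)"])
    (use tensor_error_le in \<open>simp add: mult.assoc\<close>)

lemma kl_converges:
  assumes "converges_geometrically (\<lambda>k. B (Suc k)) U"
  shows "converges_geometrically (\<lambda>k. kl_div (p $ j) (s (Suc k) j)) 0"
  by (rule converges_geometrically_compare[OF assms,
        where C = "real CARD('n) * (real CARD('n ^ 'd) / c)"])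
    (use kl_le_tensor_error[of "Suc _"] in simp)

end

section \<open>Conclusions for an arbitrary run\<close>

context sinkhorn_iteration
begin

lemma geometric_limit:
  "\<exists>Z. rescale A Z \<in> transport_polytope p \<and> converges_geometrically X Z \<and>
    converges_geometrically B (rescale A Z) \<and>
    (\<forall>j. converges_geometrically (\<lambda>k. kl_div (p $ j) (s k j)) 0)"
proof -
  obtain f Z where f: "strict_mono f" "((\<lambda>k. X (Suc k)) \<circ> f) \<longlonglongrightarrow> Z"
    and Z: "rescale A Z \<in> transport_polytope p"
    by (rule accumulation_point)
  obtain c where c: "0 < c" "\<And>k m. 1 \<le> k \<Longrightarrow> c \<le> B k $ m"
    using B_bounded_below by blast
  \<comment> \<open>One lower bound for the entries of the iterates from index 1 on and of the
    limit.\<close>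
  define c' where "c' = min c (Min (range (($) (rescale A Z))))"
  interpret sinkhorn_limit A p X l Z c'
  proof
    show "0 < c'" using c rescale_pos by (simp add: c'_def)
  qed (use Z c in \<open>auto simp: c'_def min.coboundedI1 min.coboundedI2\<close>)
  obtain K r where "0 < r" "r < 1" "\<And>k. norm (X (Suc (Suc k)) - X (Suc k)) \<le> K * r ^ k"
    using steps_geometric by blast
  \<comment> \<open>The limit along \<open>f\<close> becomes the limit of the whole
    sequence.\<close>
  then have X: "converges_geometrically (\<lambda>k. X (Suc k)) Z"
    by (intro converges_geometrically_of_steps[OF _ _ _ f])
  note B = tensors_converge[OF X]
  show ?thesis
  proof (intro exI[of _ Z] conjI allI Z)
    show "converges_geometrically X Z"
      using X by (rule converges_geometrically_unshift)
    show "converges_geometrically B (rescale A Z)"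
      using B by (rule converges_geometrically_unshift)
    show "converges_geometrically (\<lambda>k. kl_div (p $ j) (s k j)) 0" for j
      using kl_converges[OF B] by (rule converges_geometrically_unshift)
  qed
qed

text \<open>The exponential parts are total masses, both 1, and cancel; only the linear part
  changes.\<close>

lemma g_fun_decrease:
  assumes "1 \<le> k"
  shows "g_fun A p (X k) - g_fun A p (X (Suc k)) = (\<Sum>j\<in>UNIV. p $ j \<bullet> (X (Suc k) $ j - X k $ j))"
proof -
  have "(\<Sum>m\<in>UNIV. B (Suc k) $ m) = 1" by (rule mass) simp
  then show ?thesis
    unfolding g_fun_rescale mass[OF assms] inner_diff_right sum_subtractf by simp
qed

end

theorem theorem3p3:
  fixes A :: "('n::finite, 'd::finite) tensor" and p :: "real ^ 'n ^ 'd"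
  assumes "2 \<le> CARD('d)"
    and "\<forall>j. p $ j \<in> pos_prob_vectors"
    and "\<forall>m. 0 < A $ m"
  shows
    "(\<exists>!U. U \<in> transport_polytope p \<and>
        (\<forall>X l. sinkhorn_run A p X l \<longrightarrow>
           converges_geometrically (\<lambda>k. rescale A (X k)) U)) \<and>
     (\<forall>X l. sinkhorn_run A p X l \<longrightarrow>
        (\<forall>j. converges_geometrically (\<lambda>k. kl_div (p $ j) (marginal j (rescale A (X k)))) 0) \<and>
        (\<exists>X'. is_arg_min (g_fun A p) (\<lambda>Y. True) X' \<and> converges_geometrically X X') \<and>
        (\<forall>k\<ge>1.
           g_fun A p (X k) - g_fun A p (X (k + 1)) =
             (\<Sum>j\<in>UNIV. p $ j \<bullet> (X (k + 1) $ j - X k $ j)) \<and>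
           (\<Sum>j\<in>UNIV. p $ j \<bullet> (X (k + 1) $ j - X k $ j)) =
             p $ l k \<bullet> (X (k + 1) $ l k - X k $ l k) \<and>
           p $ l k \<bullet> (X (k + 1) $ l k - X k $ l k) =
             kl_div (p $ l k) (marginal (l k) (rescale A (X k)))))"
proof -
  interpret positive_scaling A p
    using assms(2,3) by unfold_locales
  have iteration: "sinkhorn_iteration A p X l" if "sinkhorn_run A p X l" for X l
    using that by unfold_locales
  obtain X0 l0 where run0: "sinkhorn_run A p X0 l0" using sinkhorn_run_exists by blast
  obtain Z0 where Z0: "rescale A Z0 \<in> transport_polytope p"
    "converges_geometrically (\<lambda>k. rescale A (X0 k)) (rescale A Z0)"
    using sinkhorn_iteration.geometric_limit[OF iteration[OF run0]] by blast
  \<comment> \<open>Runs with different choices at ties, or different log-scalings \<open>Z\<close>,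
    still share the limit tensor, by uniqueness of the scaling.\<close>
  have "converges_geometrically (\<lambda>k. rescale A (X k)) (rescale A Z0)"
    if run: "sinkhorn_run A p X l" for X l
  proof -
    obtain Z where Z: "rescale A Z \<in> transport_polytope p"
      "converges_geometrically (\<lambda>k. rescale A (X k)) (rescale A Z)"
      using sinkhorn_iteration.geometric_limit[OF iteration[OF run]] by blast
    then show ?thesis using scaling_unique[OF Z0(1) Z(1)] by simp
  qed
  \<comment> \<open>Any competing tensor is tested on the run \<open>X0\<close>, whose limit is
    unique.\<close>
  moreover have "V = rescale A Z0" if "converges_geometrically (\<lambda>k. rescale A (X0 k)) V" for V
    using LIMSEQ_unique converges_geometrically_imp_tendsto that Z0(2) by blast
  ultimately have a: "\<exists>!U. U \<in> transport_polytope p \<and>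
      (\<forall>X l. sinkhorn_run A p X l \<longrightarrow> converges_geometrically (\<lambda>k. rescale A (X k)) U)"
    using Z0(1) run0 by blast
  show ?thesis
  proof (intro conjI[OF a] allI impI)
    fix X l assume "sinkhorn_run A p X l"
    then interpret sinkhorn_iteration A p X l by (rule iteration)
    obtain Z where Z: "rescale A Z \<in> transport_polytope p" "converges_geometrically X Z"
      and kl: "\<And>j. converges_geometrically (\<lambda>k. kl_div (p $ j) (marginal j (rescale A (X k)))) 0"
      using geometric_limit by blast
    have d: "g_fun A p (X k) - g_fun A p (X (k + 1)) =
             (\<Sum>j\<in>UNIV. p $ j \<bullet> (X (k + 1) $ j - X k $ j)) \<and>
           (\<Sum>j\<in>UNIV. p $ j \<bullet> (X (k + 1) $ j - X k $ j)) =
             p $ l k \<bullet> (X (k + 1) $ l k - X k $ l k) \<and>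
           p $ l k \<bullet> (X (k + 1) $ l k - X k $ l k) =
             kl_div (p $ l k) (marginal (l k) (rescale A (X k)))" if "1 \<le> k" for k
      using g_fun_decrease[OF that] sum_inner_increment[of k] inner_increment[of "l k" k] by simp
    show "(\<forall>j. converges_geometrically (\<lambda>k. kl_div (p $ j) (marginal j (rescale A (X k)))) 0) \<and>
        (\<exists>X'. is_arg_min (g_fun A p) (\<lambda>Y. True) X' \<and> converges_geometrically X X') \<and>
        (\<forall>k\<ge>1.
           g_fun A p (X k) - g_fun A p (X (k + 1)) =
             (\<Sum>j\<in>UNIV. p $ j \<bullet> (X (k + 1) $ j - X k $ j)) \<and>
           (\<Sum>j\<in>UNIV. p $ j \<bullet> (X (k + 1) $ j - X k $ j)) =
             p $ l k \<bullet> (X (k + 1) $ l k - X k $ l k) \<and>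
           p $ l k \<bullet> (X (k + 1) $ l k - X k $ l k) =
             kl_div (p $ l k) (marginal (l k) (rescale A (X k))))"
      using kl scaling_minimizes[OF Z(1)] Z(2) d by blast
  qed
qed

end
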